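(* Let $N$ be a nonnegative integer. There exists a real valued trigonometric polynomial $v_N(x) = \sum_{n=-N}^{N} \widehat{v}_N(n)e(nx)$ such that for every trigonometric polynomial $\widetilde{v}(x)$ of degree at most $N$, $$\int_{\mathbb{R}/\mathbb{Z}} \left| \log|1 - e(x)| - \widetilde{v}(x) \right| \,\mathrm{d}x \geq \frac{4G}{(2N+2)\pi},$$ with equality if and only if $\widetilde{v}(x) = v_N(x)$. Here $G=\sum_{n=0}^\infty\frac{(-1)^n}{(2n+1)^2}$ is Catalan's constant.
   Context: $e(x)=e^{2\pi i x}$. Integration over $\mathbb{R}/\mathbb{Z}$ is with respect to Haar measure normalized to total mass $1$. A trigonometric polynomial of degree at most $N$ is a function $\sum_{n=-N}^N c_n e(nx)$. *)

theory Defs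
  imports "HOL-Analysis.Analysis"
begin

definition e :: "real \<Rightarrow> complex" where
  "e x = exp (2 * pi * \<i> * complex_of_real x)"

definition trig_poly :: "nat \<Rightarrow> (int \<Rightarrow> complex) \<Rightarrow> real \<Rightarrow> complex" where
  "trig_poly N c = (\<lambda>x. \<Sum>n\<in>{-int N..int N}. c n * e (of_int n * x))"

definition catalan_G :: real where
  "catalan_G = (\<Sum>n. (-1) ^ n / (2 * real n + 1) ^ 2)"

text \<open>L^1 distance on R/Z (normalized Haar measure = Lebesgue measure on [0,1])
  between log|1 - e(x)| and a function v.\<close>
definition log_L1_dist :: "(real \<Rightarrow> complex) \<Rightarrow> real" where
  "log_L1_dist v = (LINT x:{0..1}|lborel. cmod (complex_of_real (ln (cmod (1 - e x))) - v x))"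

end

theory Submission
  imports Defs
begin

text \<open>Put \<open>f x = ln |1 - e x|\<close>, \<open>m = N + 1\<close> and \<open>s x = sgn (cos (2 \<pi> m x))\<close>. The Fourier series of \<open>s\<close>
  contains only odd multiples of \<open>m\<close>, so \<open>s\<close> is orthogonal to all trigonometric polynomials of degree
  at most \<open>N\<close>, and \<open>\<integral> f s = - 2 G / (m \<pi>)\<close> by pairing it with the Fourier series
  \<open>f x = - (\<Sum>n\<ge>1. cos (2 \<pi> n x) / n)\<close>. Duality gives the lower bound. For a minimiser write
  \<open>f x = ln (2 - 2 t) / 2\<close> with \<open>t = cos (2 \<pi> x)\<close> and interpolate this function of \<open>t\<close> at the \<open>m\<close>
  zeros of the Chebyshev polynomial \<open>T\<^sub>m\<close>: the interpolation error has exactly the sign of \<open>- T\<^sub>m t\<close>,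
  hence of \<open>- s x\<close>. Conversely, if \<open>v\<close> attains the bound then \<open>(f - v) s \<le> 0\<close>, so \<open>f - v\<close> vanishes
  at the \<open>2 m\<close> sign changes of \<open>s\<close>, and \<open>v\<close> is determined by its values there.\<close>

section \<open>Interpolation\<close>

text \<open>\<open>D k\<close> stands for the \<open>k\<close>-th derivative of \<open>D 0\<close>.
  Rolle's theorem between neighbouring zeros loses exactly one zero per derivative, so
  \<open>n + 1\<close> zeros leave one for \<open>D n\<close>; the interval \<open>I\<close>
  contains all intermediate points.\<close>

lemma iterated_Rolle:
  fixes D :: "nat \<Rightarrow> real \<Rightarrow> real"
  assumes "is_interval I"
    and "finite S" "card S = Suc n" "S \<subseteq> I"
    and "\<And>x. x \<in> S \<Longrightarrow> D 0 x = 0"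
    and "\<And>k x. k < n \<Longrightarrow> x \<in> I \<Longrightarrow> (D k has_real_derivative D (Suc k) x) (at x)"
  shows "\<exists>\<xi>\<in>I. D n \<xi> = 0"
  using assms(2-)
proof (induction n arbitrary: D S)
  case 0
  then obtain x where "x \<in> S" by (metis card.empty ex_in_conv nat.distinct(1))
  then show ?case using 0 by auto
next
  case (Suc n)
  \<comment> \<open>\<open>nxt s\<close> is the right neighbour of \<open>s\<close> in
    \<open>S\<close>; the maximum has none and is dropped in \<open>S'\<close>.\<close>
  define nxt where "nxt s = Min {y\<in>S. s < y}" for s
  define S' where "S' = S - {Max S}"
  have ne: "S \<noteq> {}" using Suc.prems by auto
  have nxt: "nxt s \<in> S" "s < nxt s" "\<And>y. y \<in> S \<Longrightarrow> s < y \<Longrightarrow> nxt s \<le> y" if "s \<in> S'" for s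
  proof -
    have fin: "finite {y\<in>S. s < y}" using Suc.prems by auto
    have "s < Max S" using that Suc.prems(1) by (simp add: S'_def less_le)
    then have "{y\<in>S. s < y} \<noteq> {}" using Max_in[OF Suc.prems(1) ne] by auto
    then show "nxt s \<in> S" "s < nxt s" using Min_in[OF fin] unfolding nxt_def by auto
    show "nxt s \<le> y" if "y \<in> S" "s < y" for y
      unfolding nxt_def using that fin by (intro Min_le) auto
  qed
  have "\<exists>r. s < r \<and> r < nxt s \<and> D 1 r = 0" if s: "s \<in> S'" for s
  proof -
    have I: "x \<in> I" if "s \<le> x" "x \<le> nxt s" for x
      using that nxt[OF s] s Suc.prems(3) assms(1) unfolding is_interval_1 S'_def
      by (metis DiffD1 subsetD)
    have d: "(D 0 has_real_derivative D 1 x) (at x)" if "s \<le> x" "x \<le> nxt s" for x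
      using Suc.prems(5)[of 0 x] I[OF that] by simp
    have "\<exists>z>s. z < nxt s \<and> DERIV (D 0) z :> 0"
    proof (rule Rolle)
      show "s < nxt s" using nxt[OF s] by simp
      show "D 0 s = D 0 (nxt s)" using Suc.prems(4) nxt[OF s] s by (simp add: S'_def)
      show "continuous_on {s..nxt s} (D 0)"
        by (intro continuous_at_imp_continuous_on) (auto intro!: DERIV_isCont d)
      show "D 0 differentiable (at x)" if "s < x" "x < nxt s" for x
        using d[of x] that real_differentiable_def by (metis less_imp_le)
    qed
    then show ?thesis using d DERIV_unique by (metis less_imp_le)
  qed
  then obtain r where r: "\<And>s. s \<in> S' \<Longrightarrow> s < r s \<and> r s < nxt s \<and> D 1 (r s) = 0"
    by metis
  \<comment> \<open>The gaps do not overlap: \<open>r s < nxt s \<le> s' < r s'\<close>.\<close>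
  have mono: "r s < r s'" if "s \<in> S'" "s' \<in> S'" "s < s'" for s s'
    using r[OF that(1)] r[OF that(2)] nxt(3)[OF that(1), of s'] that by (auto simp: S'_def)
  have inj: "inj_on r S'"
    by (rule inj_onI) (metis mono less_irrefl linorder_neqE)
  have "\<exists>\<xi>\<in>I. D (Suc n) \<xi> = 0"
  proof (rule Suc.IH[of "r ` S'" "\<lambda>k. D (Suc k)"])
    show "finite (r ` S')" using Suc.prems(1) by (simp add: S'_def)
    show "card (r ` S') = Suc n"
      using card_image[OF inj] Suc.prems(1,2) Max_in[OF Suc.prems(1) ne] by (simp add: S'_def)
    show "r ` S' \<subseteq> I"
    proof (rule image_subsetI)
      fix s assume s: "s \<in> S'"
      then show "r s \<in> I"
        using r[OF s] nxt[OF s] Suc.prems(3) assms(1) unfolding is_interval_1 S'_def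
        by (metis DiffD1 subsetD less_imp_le)
    qed
  qed (use r Suc.prems(5) in auto)
  then show ?case .
qed

text \<open>Newton's scheme: a new node is served by adding a multiple of the product
  \<open>W\<close>, which vanishes at all old nodes.\<close>

lemma exists_interpolation_poly:
  fixes g :: "'a::field \<Rightarrow> 'a"
  assumes "finite S"
  shows "\<exists>P. degree P \<le> card S - 1 \<and> (\<forall>s\<in>S. poly P s = g s)"
  using assms
proof (induction S)
  case empty
  show ?case by (rule exI[of _ 0]) simp
next
  case (insert a S)
  then obtain P where P: "degree P \<le> card S - 1" "\<forall>s\<in>S. poly P s = g s" by blast
  define W where "W = (\<Prod>s\<in>S. [:- s, 1:])"
  have dW: "degree W \<le> card S"
    unfolding W_def by (rule order_trans[OF degree_prod_sum_le]) (use insert in auto)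
  have W0: "poly W s = 0" if "s \<in> S" for s
    using that insert(1) by (auto simp: W_def poly_prod)
  have Wa: "poly W a \<noteq> 0"
    using insert(1,2) by (auto simp: W_def poly_prod)
  define Q where "Q = P + smult ((g a - poly P a) / poly W a) W"
  have "degree Q \<le> card S"
    unfolding Q_def using P(1) dW by (intro degree_add_le order_trans[OF degree_smult_le]) auto
  moreover have "\<forall>s\<in>insert a S. poly Q s = g s"
    using P(2) W0 Wa by (auto simp: Q_def)
  ultimately show ?case using insert by (intro exI[of _ Q]) auto
qed

text \<open>The recurrence \<open>T (n + 2) = 2 t T (n + 1) - T n\<close> mirrors the sum formula
  for cosines. The sign of the leading coefficient is carried along because it decides the sign of
  the interpolation error.\<close>

lemma exists_Chebyshev_poly:
  "\<exists>T::real poly. degree T \<le> n \<and> coeff T n > 0 \<and> (\<forall>\<theta>. poly T (cos \<theta>) = cos (real n * \<theta>))"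
proof (induction n rule: induct_nat_012)
  case 0
  show ?case by (rule exI[of _ 1]) auto
next
  case 1
  show ?case by (rule exI[of _ "[:0, 1:]"]) auto
next
  case (ge2 n)
  then obtain A B :: "real poly" where A: "degree A \<le> n" "\<forall>\<theta>. poly A (cos \<theta>) = cos (real n * \<theta>)"
    and B: "degree B \<le> Suc n" "coeff B (Suc n) > 0" "\<forall>\<theta>. poly B (cos \<theta>) = cos (real (Suc n) * \<theta>)"
    by blast
  define C where "C = pCons 0 (smult 2 B) - A"
  have "degree C \<le> Suc (Suc n)"
    unfolding C_def using A(1) B(1)
    by (intro degree_diff_le order_trans[OF degree_pCons_le]) auto
  moreover have "coeff C (Suc (Suc n)) > 0"
    unfolding C_def using A(1) B(2) by (simp add: coeff_eq_0)
  moreover have "poly C (cos \<theta>) = cos (real (Suc (Suc n)) * \<theta>)" for \<theta>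
  proof -
    have "cos (real (Suc (Suc n)) * \<theta>) + cos (real n * \<theta>) = 2 * cos \<theta> * cos (real (Suc n) * \<theta>)"
      using cos_add[of "real (Suc n) * \<theta>" \<theta>] cos_diff[of "real (Suc n) * \<theta>" \<theta>]
      by (simp add: algebra_simps)
    then show ?thesis using A(2) B(3) by (simp add: C_def)
  qed
  ultimately show ?case by blast
qed

lemma higher_pderiv_degree_le:
  fixes p :: "real poly"
  assumes "degree p \<le> n"
  shows "(pderiv ^^ n) p = [:fact n * coeff p n:]"
proof (rule poly_eqI)
  fix k
  show "coeff ((pderiv ^^ n) p) k = coeff [:fact n * coeff p n:] k"
    using assms
    by (cases k) (simp_all add: coeff_higher_pderiv coeff_eq_0 pochhammer_fact)
qed

text \<open>The factor of \<open>T\<close> is determined at a single point \<open>t\<close>; the \<open>n\<close>-th derivative of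
  \<open>ln (2 - 2 t) / 2\<close> being negative then fixes its sign.\<close>
lemma log_interpolation_error_sign:
  fixes T P :: "real poly"
  assumes T: "degree T \<le> n" "coeff T n > 0"
    and S: "finite S" "card S = n" "S \<subseteq> {..<1}" "\<And>s. s \<in> S \<Longrightarrow> poly T s = 0"
    and P: "degree P \<le> n - 1" "\<And>s. s \<in> S \<Longrightarrow> poly P s = ln (2 - 2 * s) / 2"
    and n: "n > 0" and t: "t < 1"
  shows "\<bar>ln (2 - 2 * t) / 2 - poly P t\<bar> = - (ln (2 - 2 * t) / 2 - poly P t) * sgn (poly T t)"
proof (cases "poly T t = 0")
  case True
  have T0: "T \<noteq> 0" using T(2) by auto
  \<comment> \<open>\<open>T\<close> has at most \<open>n\<close> roots, so a root \<open>t\<close>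
    is itself a node and both sides are zero.\<close>
  have "S = {x. poly T x = 0}"
  proof (rule card_seteq)
    show "card {x. poly T x = 0} \<le> card S"
      using card_poly_roots_bound[OF T0] T S by simp
  qed (use S poly_roots_finite[OF T0] in auto)
  then show ?thesis using True P by simp
next
  case False
  \<comment> \<open>With this \<open>c\<close> the polynomial \<open>R\<close> also matches the
    logarithm at \<open>t\<close>, so the difference has \<open>n + 1\<close> zeros.\<close>
  define c where "c = (ln (2 - 2 * t) / 2 - poly P t) / poly T t"
  define R where "R = P + smult c T"
  \<comment> \<open>The \<open>k\<close>-th derivative of \<open>ln (2 - 2 u) / 2 - R u\<close> in
    closed form.\<close>
  define D where "D k u = (if k = 0 then ln (2 - 2 * u) / 2 else - fact (k - 1) / (2 * (1 - u) ^ k))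
       - poly ((pderiv ^^ k) R) u" for k and u :: real
  have tS: "t \<notin> S" using S(4) False by auto
  have "\<exists>\<xi>\<in>{..<1}. D n \<xi> = 0"
  proof (rule iterated_Rolle)
    show "is_interval {..<1::real}" by (rule is_interval_io)
    show "finite (insert t S)" "card (insert t S) = Suc n" "insert t S \<subseteq> {..<1}" using S tS t by auto
    show "D 0 x = 0" if "x \<in> insert t S" for x
      using that S(4) P(2) False by (auto simp: D_def R_def c_def)
    show "(D k has_real_derivative D (Suc k) x) (at x)" if "x \<in> {..<1}" for k x
    proof (cases k)
      case 0
      then show ?thesis using that unfolding D_def
        by (auto intro!: derivative_eq_intros simp: field_simps)
    next
      case (Suc j)
      define y where "y = 1 - x"
      have y: "y \<noteq> 0" using that by (simp add: y_def)
      have "((\<lambda>u. (1 - u) ^ Suc j) has_real_derivative - (real (Suc j) * y ^ j)) (at x)"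
        unfolding y_def by (auto intro!: derivative_eq_intros simp del: power_Suc)
      then have "((\<lambda>u. - fact j / 2 / (1 - u) ^ Suc j) has_real_derivative
          (0 * y ^ Suc j - (- fact j / 2) * - (real (Suc j) * y ^ j)) / (y ^ Suc j * y ^ Suc j)) (at x)"
        unfolding y_def by (intro DERIV_divide DERIV_const) (use y in \<open>auto simp: y_def\<close>)
      moreover have "(0 * y ^ Suc j - (- fact j / 2) * - (real (Suc j) * y ^ j)) / (y ^ Suc j * y ^ Suc j)
          = - fact (Suc j) / (2 * y ^ Suc (Suc j))"
        using y by (simp add: field_simps)
      ultimately have "((\<lambda>u. - fact j / (2 * (1 - u) ^ Suc j)) has_real_derivative
          - fact (Suc j) / (2 * (1 - x) ^ Suc (Suc j))) (at x)"
        by (simp only: y_def divide_divide_eq_left)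
      then show ?thesis unfolding D_def Suc
        by (auto intro!: derivative_intros)
    qed
  qed
  then obtain \<xi> where \<xi>: "\<xi> < 1" "D n \<xi> = 0" by auto
  have dR: "degree R \<le> n"
    unfolding R_def using P T by (intro degree_add_le order_trans[OF degree_smult_le]) auto
  \<comment> \<open>Only \<open>c T\<close> contributes to the \<open>n\<close>-th derivative of
    \<open>R\<close>, so \<open>c\<close> inherits the negative sign of the \<open>n\<close>-th
    derivative of the logarithm.\<close>
  have "coeff P n = 0" using P(1) n by (intro coeff_eq_0) auto
  then have "poly ((pderiv ^^ n) R) \<xi> = fact n * (c * coeff T n)"
    unfolding higher_pderiv_degree_le[OF dR] by (simp add: R_def)
  then have "fact n * (c * coeff T n) = - fact (n - 1) / (2 * (1 - \<xi>) ^ n)"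
    using \<xi>(2) n by (simp add: D_def)
  also have "\<dots> < 0" using \<xi>(1) by simp
  finally have "c < 0" using T(2) by (simp add: mult_less_0_iff zero_less_mult_iff)
  moreover have "ln (2 - 2 * t) / 2 - poly P t = c * poly T t" using False by (simp add: c_def)
  ultimately show ?thesis by (simp add: abs_mult sgn_real_def)
qed

section \<open>Integration over the circle\<close>

lemma e_add: "e (x + y) = e x * e y"
  by (simp add: e_def distrib_left exp_add)

lemma e_0 [simp]: "e 0 = 1"
  by (simp add: e_def)

lemma e_eq_cis: "e x = cis (2 * pi * x)"
  by (simp add: e_def cis_conv_exp mult_ac)

lemma norm_e [simp]: "cmod (e x) = 1"
  by (simp add: e_eq_cis)

lemma Re_e: "Re (e x) = cos (2 * pi * x)"
  by (simp add: e_eq_cis)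

lemma e_minus: "e (- x) = cnj (e x)"
  by (simp add: e_eq_cis cis_cnj)

lemma cos_eq_e: "complex_of_real (cos (2 * pi * x)) = (e x + e (- x)) / 2"
  by (simp add: e_minus complex_add_cnj Re_e)

lemma e_power: "e x ^ n = e (real n * x)"
  unfolding e_eq_cis Complex.DeMoivre by (simp add: mult_ac)

lemma e_eq_iff: "e x = e y \<longleftrightarrow> (\<exists>n::int. x = y + of_int n)"
proof -
  have "e x = e y \<longleftrightarrow> (\<exists>n::int. 2 * pi * x = 2 * pi * y + 2 * pi * of_int n)"
    unfolding e_def exp_eq
    by (simp add: complex_eq_iff mult_ac)
  also have "\<dots> \<longleftrightarrow> (\<exists>n::int. x = y + of_int n)"
    unfolding distrib_left[symmetric] by simp
  finally show ?thesis .
qed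

lemma e_of_int [simp]: "e (of_int n) = 1"
  using e_eq_iff[of "of_int n" 0] by simp

lemma e_neq_1: "0 < x \<Longrightarrow> x < 1 \<Longrightarrow> e x \<noteq> 1"
  using e_eq_iff[of x 0] by auto

lemma continuous_on_e [continuous_intros]:
  "continuous_on S f \<Longrightarrow> continuous_on S (\<lambda>x. e (f x))"
  unfolding e_def by (intro continuous_intros)

lemma e_measurable [measurable]: "e \<in> borel_measurable borel"
  by (intro borel_measurable_continuous_onI continuous_intros)

text \<open>This turns \<open>ln (cmod (1 - e x))\<close> into a function of the cosine alone and so
  opens the way to algebraic interpolation.\<close>

lemma cmod_1_minus_e: "cmod (1 - e x) ^ 2 = 2 - 2 * cos (2 * pi * x)"
  unfolding cmod_power2 e_eq_cis
  using sin_cos_squared_add[of "2 * pi * x"]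
  by (simp add: power2_eq_square algebra_simps)

text \<open>The circle as a measure space of mass 1. Both endpoints stand for the same point, which
  is harmless since they form a null set.\<close>

definition circ :: "real measure" where
  "circ = restrict_space lborel {0..1}"

lemma space_circ: "space circ = {0..1}"
  by (simp add: circ_def space_restrict_space)

lemma measurable_circ [measurable_dest]: "f \<in> borel_measurable borel \<Longrightarrow> f \<in> borel_measurable circ"
  unfolding circ_def by (rule measurable_restrict_space1) simp

lemma integral_circ:
  fixes f :: "real \<Rightarrow> 'a::{banach, second_countable_topology}"
  shows "integral\<^sup>L circ f = (LINT x:{0..1}|lborel. f x)"
  unfolding circ_def set_lebesgue_integral_def by (rule integral_restrict_space) simp

lemma emeasure_circ: "emeasure circ {0..1} = 1"
  by (simp add: circ_def emeasure_restrict_space)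

interpretation circ: finite_measure circ
  by standard (simp add: space_circ emeasure_circ)

lemma measure_circ [simp]: "measure circ (space circ) = 1"
  by (simp add: measure_def space_circ emeasure_circ)

lemma AE_circ_countable:
  assumes "countable A"
  shows "AE x in circ. x \<notin> A"
  unfolding circ_def
  using AE_not_in[OF countable_imp_null_set_lborel[OF assms]]
  by (subst AE_restrict_space_iff) auto

lemma AE_circ_open: "AE x in circ. 0 < x \<and> x < 1"
proof -
  have "AE x in circ. x \<notin> {0, 1}" by (rule AE_circ_countable) simp
  then show ?thesis using AE_space by eventually_elim (auto simp: space_circ)
qed

lemma integrable_circ_continuous:
  fixes f :: "real \<Rightarrow> 'a::{banach, second_countable_topology}"
  assumes "continuous_on UNIV f"
  shows "integrable circ f"
proof -
  have "bounded (f ` {0..1})"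
    using assms by (intro compact_imp_bounded compact_continuous_image) (auto intro: continuous_on_subset)
  then obtain B where "\<And>x. x \<in> {0..1} \<Longrightarrow> norm (f x) \<le> B" unfolding bounded_iff by blast
  then show ?thesis
    by (intro circ.integrable_const_bound[where B=B] AE_I2 measurable_circ
        borel_measurable_continuous_onI assms) (auto simp: space_circ)
qed

text \<open>For \<open>n \<noteq> 0\<close> the antiderivative \<open>F\<close> has period 1, so its
  increment over the interval is zero.\<close>

lemma integral_e: "integral\<^sup>L circ (\<lambda>x. e (of_int n * x)) = of_bool (n = 0)"
proof (cases "n = 0")
  case False
  define F where "F x = e (of_int n * x) / (2 * pi * \<i> * of_int n)" for x
  have "integral\<^sup>L circ (\<lambda>x. e (of_int n * x)) = F 1 - F 0"
    unfolding integral_circ set_lebesgue_integral_def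
  proof (rule integral_FTC_Icc)
    show "(F has_vector_derivative e (of_int n * x)) (at x within {0..1})" for x
    proof -
      have "((\<lambda>z. exp (2 * pi * \<i> * (of_int n * z)) / (2 * pi * \<i> * of_int n)) has_field_derivative
        exp (2 * pi * \<i> * (of_int n * of_real x))) (at (of_real x))"
        using False by (auto intro!: derivative_eq_intros)
      from has_vector_derivative_real_field[OF this] show ?thesis
        by (simp add: F_def[abs_def] e_def)
    qed
  qed (auto intro!: continuous_intros)
  then show ?thesis using False by (simp add: F_def)
qed simp

text \<open>The cosine is the mean of two characters, each of which picks out one frequency. For
  \<open>m = 0\<close> both indicators fire at \<open>n = 0\<close> and give 1.\<close>

lemma integral_cos_mult_e:
  "integral\<^sup>L circ (\<lambda>x. cos (2 * pi * (real m * x)) *\<^sub>R e (of_int n * x))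
     = (of_bool (n = - int m) + of_bool (n = int m)) / 2"
proof -
  have eq: "cos (2 * pi * (real m * x)) *\<^sub>R e (of_int n * x)
      = (e (of_int (n + int m) * x) + e (of_int (n - int m) * x)) / 2" for x
    unfolding scaleR_conv_of_real cos_eq_e
    by (simp add: e_add[symmetric] field_simps)
  have int: "integrable circ (\<lambda>x. e (of_int k * x))" for k
    by (intro integrable_circ_continuous continuous_intros)
  show ?thesis
    unfolding eq by (simp add: int integral_e eq_neg_iff_add_eq_0 del: of_int_add of_int_diff)
qed

lemma integral_cos_mult_cos:
  assumes "n > 0"
  shows "integral\<^sup>L circ (\<lambda>x. cos (2 * pi * (real n * x)) * cos (2 * pi * (real m * x)))
     = of_bool (n = m) / 2"
proof -
  have "integral\<^sup>L circ (\<lambda>x. cos (2 * pi * (real n * x)) * cos (2 * pi * (real m * x)))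
     = Re (integral\<^sup>L circ (\<lambda>x. cos (2 * pi * (real n * x)) *\<^sub>R e (of_int (int m) * x)))"
    by (subst integral_Re[symmetric]) (auto intro!: integrable_circ_continuous continuous_intros simp: Re_e)
  then show ?thesis using assms unfolding integral_cos_mult_e by auto
qed

section \<open>Fourier coefficients of the logarithm\<close>

text \<open>The real part of the power series of \<open>Ln (1 - z)\<close> at
  \<open>z = r * e x\<close>. The term \<open>n = 0\<close> is zero because division by zero yields
  0.\<close>

lemma ln_cmod_1_minus_e_sums:
  fixes r :: real
  assumes "0 \<le> r" "r < 1"
  shows "(\<lambda>n. - (r ^ n / real n) * cos (2 * pi * (real n * x))) sums ln (cmod (1 - r * e x))"
proof -
  have "(\<lambda>n. - ((- (- r * e x)) ^ n) / of_nat n) sums ln (1 + - r * e x)"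
    by (rule Ln_series') (use assms in \<open>simp add: norm_mult\<close>)
  then have "(\<lambda>n. Re (- ((r * e x) ^ n) / of_nat n)) sums Re (ln (1 - r * e x))"
    by (intro sums_Re) simp
  moreover have "(\<lambda>n. Re (- ((r * e x) ^ n) / of_nat n)) =
      (\<lambda>n. - (r ^ n / real n) * cos (2 * pi * (real n * x)))"
    by (rule ext) (simp add: power_mult_distrib e_power Re_e flip: of_real_power)
  moreover have "1 - r * e x \<noteq> 0"
  proof
    assume "1 - r * e x = 0"
    then have "cmod (r * e x) = 1" by (metis eq_iff_diff_eq_0 norm_one)
    then show False using assms by (simp add: norm_mult)
  qed
  ultimately show ?thesis by (simp only: Re_Ln not_False_eq_True)
qed

text \<open>Bounds uniform in \<open>r\<close>, used to let \<open>r\<close> tend to 1. The last one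
  holds because \<open>1 - r\<close> is at most \<open>cmod (1 - r * e x)\<close>.\<close>

lemma cmod_1_minus_scaled_e:
  fixes r :: real
  assumes "0 \<le> r" "r < 1"
  shows "cmod (1 - r * e x) > 0" "cmod (1 - r * e x) \<le> 2" "cmod (1 - e x) \<le> 2 * cmod (1 - r * e x)"
proof -
  have n: "cmod (r * e x) = r" using assms by (simp add: norm_mult)
  have l: "cmod (1 - r * e x) \<ge> 1 - r" using norm_triangle_ineq2[of 1 "r * e x"] n by simp
  then show "cmod (1 - r * e x) > 0" using assms by linarith
  show "cmod (1 - r * e x) \<le> 2" using norm_triangle_ineq4[of 1 "r * e x"] n assms by simp
  have "cmod (1 - e x) \<le> cmod (1 - r * e x) + cmod (of_real (1 - r) * e x)"
    using norm_triangle_ineq4[of "1 - r * e x" "(1 - r) * e x"] by (simp add: algebra_simps)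
  also have "cmod (of_real (1 - r) * e x) = 1 - r"
    unfolding norm_mult norm_of_real using assms by simp
  finally show "cmod (1 - e x) \<le> 2 * cmod (1 - r * e x)" using l by simp
qed

text \<open>Inside the unit disc the series is dominated by a geometric one, so it integrates
  termwise and orthogonality keeps only \<open>n = m\<close>. For \<open>m = 0\<close> the
  right-hand side is 0, the correct mean value.\<close>

lemma integral_ln_scaled_mult_cos:
  fixes r :: real
  assumes r: "0 \<le> r" "r < 1"
  shows "integral\<^sup>L circ (\<lambda>x. ln (cmod (1 - r * e x)) * cos (2 * pi * (real m * x)))
    = - (r ^ m / real m) / 2"
proof -
  define f where "f n x = - (r ^ n / real n) * cos (2 * pi * (real n * x)) * cos (2 * pi * (real m * x))"
    for n x
  have int: "integrable circ (f n)" for n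
    unfolding f_def by (intro integrable_circ_continuous continuous_intros)
  have bnd: "norm (f n x) \<le> r ^ n" for n x
  proof -
    have "norm (f n x) \<le> \<bar>r ^ n / real n\<bar> * 1 * 1"
      unfolding f_def norm_mult by (intro mult_mono) auto
    also have "\<dots> \<le> r ^ n" using r by (cases n) (auto simp: field_simps mult_left_mono)
    finally show ?thesis .
  qed
  have sum_r: "summable (\<lambda>n. r ^ n)" using r by (intro summable_geometric) auto
  have "(\<lambda>n. integral\<^sup>L circ (f n)) sums (integral\<^sup>L circ (\<lambda>x. \<Sum>n. f n x))"
  proof (rule sums_integral[OF int])
    show "AE x in circ. summable (\<lambda>n. norm (f n x))"
      by (intro AE_I2 summable_comparison_test'[OF sum_r]) (use bnd in auto)
    have "norm (integral\<^sup>L circ (\<lambda>x. norm (f n x))) \<le> r ^ n" for n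
    proof -
      have "integral\<^sup>L circ (\<lambda>x. norm (f n x)) \<le> integral\<^sup>L circ (\<lambda>x. r ^ n)"
        by (intro integral_mono integrable_norm int) (use bnd in auto)
      then show ?thesis by simp
    qed
    then show "summable (\<lambda>n. integral\<^sup>L circ (\<lambda>x. norm (f n x)))"
      by (intro summable_comparison_test'[OF sum_r])
  qed
  moreover have "(\<Sum>n. f n x) = ln (cmod (1 - r * e x)) * cos (2 * pi * (real m * x))" for x
    unfolding f_def
    by (rule sums_unique[symmetric], rule sums_mult2, rule ln_cmod_1_minus_e_sums[OF r])
  moreover have "integral\<^sup>L circ (f n) = (if n = m then - (r ^ m / real m) / 2 else 0)" for n
  proof (cases "n = 0")
    case False
    have "f n = (\<lambda>x. - (r ^ n / real n) * (cos (2 * pi * (real n * x)) * cos (2 * pi * (real m * x))))"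
      by (rule ext) (simp add: f_def)
    then have "integral\<^sup>L circ (f n) = - (r ^ n / real n) * (of_bool (n = m) / 2)"
      using integral_cos_mult_cos[of n m] False by (simp only: integral_mult_right_zero)
    then show ?thesis by simp
  qed (simp add: f_def[abs_def])
  ultimately have "(\<lambda>n. if n = m then - (r ^ m / real m) / 2 else 0) sums
      integral\<^sup>L circ (\<lambda>x. ln (cmod (1 - r * e x)) * cos (2 * pi * (real m * x)))"
    by simp
  then show ?thesis
    using sums_single[of m "\<lambda>_. - (r ^ m / real m) / 2"] by (rule sums_unique2)
qed

text \<open>Radii increasing to 1, along which all Abel limits are taken.\<close>

lemma n_over_Suc_n_bounds:
  fixes j :: nat
  shows "0 \<le> real j / real (Suc j)" "real j / real (Suc j) < 1"
  by (auto simp: field_simps)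

lemma tendsto_ln_cmod_1_minus_scaled_e:
  assumes "0 < x" "x < 1"
  shows "(\<lambda>j. ln (cmod (1 - of_real (real j / real (Suc j)) * e x))) \<longlonglongrightarrow> ln (cmod (1 - e x))"
proof -
  have "(\<lambda>j. ln (cmod (1 - of_real (real j / real (Suc j)) * e x)))
      \<longlonglongrightarrow> ln (cmod (1 - of_real 1 * e x))"
    by (intro tendsto_intros LIMSEQ_n_over_Suc_n) (use e_neq_1[OF assms] in auto)
  then show ?thesis by simp
qed

text \<open>Fatou's lemma: the functions \<open>u j\<close> are nonnegative, have the constant
  integral \<open>ln 2\<close>, and converge almost everywhere to \<open>v\<close>.\<close>

lemma integrable_ln_cmod_1_minus_e: "integrable circ (\<lambda>x. ln (cmod (1 - e x)))"
proof -
  define u where "u j x = ln 2 - ln (cmod (1 - of_real (real j / real (Suc j)) * e x))" for j x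
  define v where "v x = ln 2 - ln (cmod (1 - e x))" for x
  have nonneg: "0 \<le> u j x" for j x
    unfolding u_def using cmod_1_minus_scaled_e[OF n_over_Suc_n_bounds] by simp
  have cmod2: "cmod (1 - e x) \<le> 2" for x using norm_triangle_ineq4[of 1 "e x"] by simp
  have [measurable]: "u j \<in> borel_measurable circ" "v \<in> borel_measurable circ" for j
    unfolding u_def v_def by (auto intro!: measurable_circ)
  have cont: "continuous_on UNIV (u j)" for j
    unfolding u_def using cmod_1_minus_scaled_e(1)[OF n_over_Suc_n_bounds]
    by (intro continuous_intros) (metis less_irrefl norm_zero)+
  have int: "integral\<^sup>L circ (u j) = ln 2" for j
  proof -
    have "integrable circ (\<lambda>x. ln 2 - u j x)"
      by (intro Bochner_Integration.integrable_diff integrable_circ_continuous cont) auto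
    then have "integral\<^sup>L circ (u j) = ln 2 - integral\<^sup>L circ (\<lambda>x. ln 2 - u j x)"
      by (subst Bochner_Integration.integral_diff)
        (auto intro: integrable_circ_continuous cont)
    \<comment> \<open>The frequency \<open>m = 0\<close> gives mean value 0 for the scaled
      logarithm.\<close>
    then show ?thesis
      using integral_ln_scaled_mult_cos[OF n_over_Suc_n_bounds, of j 0] by (simp add: u_def)
  qed
  have "(\<integral>\<^sup>+x. ennreal (v x) \<partial>circ) = (\<integral>\<^sup>+x. liminf (\<lambda>j. ennreal (u j x)) \<partial>circ)"
  proof (rule nn_integral_cong_AE)
    show "AE x in circ. ennreal (v x) = liminf (\<lambda>j. ennreal (u j x))"
      using AE_circ_open
    proof eventually_elim
      case (elim x)
      then have "(\<lambda>j. ennreal (u j x)) \<longlonglongrightarrow> ennreal (v x)"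
        unfolding u_def v_def by (intro tendsto_intros tendsto_ln_cmod_1_minus_scaled_e) auto
      then show ?case by (rule lim_imp_Liminf[OF sequentially_bot, symmetric])
    qed
  qed
  also have "\<dots> \<le> liminf (\<lambda>j. \<integral>\<^sup>+x. ennreal (u j x) \<partial>circ)"
    by (rule nn_integral_liminf) simp
  also have "(\<lambda>j. \<integral>\<^sup>+x. ennreal (u j x) \<partial>circ) = (\<lambda>j. ennreal (ln 2))"
    by (subst nn_integral_eq_integral) (auto intro: integrable_circ_continuous cont nonneg simp: int)
  also have "liminf (\<lambda>j::nat. ennreal (ln 2)) < \<infinity>"
    by (simp add: Liminf_const)
  finally have "(\<integral>\<^sup>+x. ennreal (v x) \<partial>circ) < \<infinity>" .
  moreover have "AE x in circ. 0 \<le> v x"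
    using AE_circ_open
  proof eventually_elim
    case (elim x)
    then show ?case using e_neq_1[of x] cmod2[of x] by (simp add: v_def)
  qed
  ultimately have "integrable circ v" by (intro integrableI_nonneg) auto
  then have "integrable circ (\<lambda>x. ln 2 - v x)"
    by (intro Bochner_Integration.integrable_diff) auto
  then show ?thesis by (simp add: v_def)
qed

text \<open>The radius tends to 1 under dominated convergence; the majorant is integrable by the
  preceding lemma.\<close>

lemma integral_ln_mult_cos:
  "integral\<^sup>L circ (\<lambda>x. ln (cmod (1 - e x)) * cos (2 * pi * (real m * x))) = - (1 / real m) / 2"
proof (rule LIMSEQ_unique)
  define r where "r j = real j / real (Suc j)" for j
  have r: "0 \<le> r j" "r j < 1" for j unfolding r_def by (rule n_over_Suc_n_bounds)+
  show "(\<lambda>j. integral\<^sup>L circ (\<lambda>x. ln (cmod (1 - of_real (r j) * e x)) * cos (2 * pi * (real m * x))))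
     \<longlonglongrightarrow> integral\<^sup>L circ (\<lambda>x. ln (cmod (1 - e x)) * cos (2 * pi * (real m * x)))"
  proof (rule integral_dominated_convergence[where w="\<lambda>x. ln 2 + \<bar>ln (cmod (1 - e x))\<bar>"])
    show "integrable circ (\<lambda>x. ln 2 + \<bar>ln (cmod (1 - e x))\<bar>)"
      by (intro Bochner_Integration.integrable_add integrable_abs integrable_ln_cmod_1_minus_e) auto
    show "AE x in circ. (\<lambda>j. ln (cmod (1 - of_real (r j) * e x)) * cos (2 * pi * (real m * x)))
        \<longlonglongrightarrow> ln (cmod (1 - e x)) * cos (2 * pi * (real m * x))"
      using AE_circ_open unfolding r_def
      by eventually_elim (intro tendsto_mult tendsto_const tendsto_ln_cmod_1_minus_scaled_e; simp)
    show "AE x in circ. norm (ln (cmod (1 - of_real (r j) * e x)) * cos (2 * pi * (real m * x)))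
        \<le> ln 2 + \<bar>ln (cmod (1 - e x))\<bar>" for j
      using AE_circ_open
    proof eventually_elim
      case (elim x)
      note b = cmod_1_minus_scaled_e[OF r[of j], where x=x]
      have pos: "cmod (1 - e x) > 0" using e_neq_1[of x] elim by simp
      have "ln (cmod (1 - of_real (r j) * e x)) \<le> ln 2" using b by simp
      \<comment> \<open>Bounds the scaled logarithm from below, where it can be very
        negative.\<close>
      moreover have "ln (cmod (1 - e x)) \<le> ln (2 * cmod (1 - of_real (r j) * e x))"
        using b pos by (subst ln_le_cancel_iff) auto
      then have "ln (cmod (1 - e x)) \<le> ln 2 + ln (cmod (1 - of_real (r j) * e x))"
        using b by (simp add: ln_mult)
      ultimately have "\<bar>ln (cmod (1 - of_real (r j) * e x))\<bar> \<le> ln 2 + \<bar>ln (cmod (1 - e x))\<bar>"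
        by linarith
      from mult_mono[OF this abs_cos_le_one[of "2 * pi * (real m * x)"]] show ?case
        by (simp add: abs_mult)
    qed
  qed (auto intro!: measurable_circ)
  show "(\<lambda>j. integral\<^sup>L circ (\<lambda>x. ln (cmod (1 - of_real (r j) * e x)) * cos (2 * pi * (real m * x))))
     \<longlonglongrightarrow> - (1 / real m) / 2"
  proof -
    have "r \<longlonglongrightarrow> 1" unfolding r_def[abs_def] by (rule LIMSEQ_n_over_Suc_n)
    \<comment> \<open>Products with constant inverses cover \<open>m = 0\<close> without a case
      distinction.\<close>
    then have "(\<lambda>j. - (r j ^ m * inverse (real m)) * inverse 2) \<longlonglongrightarrow> - (1 ^ m * inverse (real m)) * inverse 2"
      by (intro tendsto_mult tendsto_minus tendsto_const tendsto_power)
    then show ?thesis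
      unfolding integral_ln_scaled_mult_cos[OF r] divide_inverse power_one .
  qed
qed

section \<open>The sign of the cosine\<close>

text \<open>\<open>Arctan\<close> is \<open>\<i> / 2\<close> times the logarithm of
  \<open>(1 - \<i> * z) / (1 + \<i> * z)\<close>. On the unit circle this quotient is purely
  imaginary, so its argument is \<open>pi / 2\<close> up to sign.\<close>

lemma Re_Arctan_unit_circle:
  assumes "cmod z = 1" "Re z \<noteq> 0"
  shows "Re (Arctan z) = pi / 4 * sgn (Re z)"
proof -
  have z: "Re z ^ 2 + Im z ^ 2 = 1" using assms(1) by (metis cmod_power2 one_power2)
  have "Im z < 1"
    using assms abs_Im_le_cmod[of z] z by (cases "Im z = 1") auto
  have nz: "1 + \<i> * z \<noteq> 0" using assms by (auto simp: complex_eq_iff)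
  \<comment> \<open>Found by comparing imaginary parts in
    \<open>1 - \<i> * z = \<i> * q * (1 + \<i> * z)\<close>.\<close>
  define q where "q = - Re z / (1 - Im z)"
  have "(1 - \<i> * z) = (\<i> * q) * (1 + \<i> * z)"
  proof -
    have "Re z ^ 2 = (1 - Im z) * (1 + Im z)" using z by (simp add: algebra_simps power2_eq_square)
    then have "q * Re z = - (1 + Im z)" "q * (1 - Im z) = - Re z"
      using \<open>Im z < 1\<close> by (auto simp: q_def field_simps power2_eq_square)
    then show ?thesis by (simp add: complex_eq_iff algebra_simps)
  qed
  then have eq: "(1 - \<i> * z) / (1 + \<i> * z) = \<i> * q" using nz by (simp add: field_simps)
  have "Im (Ln (\<i> * q)) = pi / 2 * sgn q"
  proof -
    have "q \<noteq> 0" using assms \<open>Im z < 1\<close> by (auto simp: q_def)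
    then consider "q > 0" | "q < 0" by linarith
    then show ?thesis
    proof cases
      case 1
      then show ?thesis using Ln_times_of_real[of q "\<i>"] by (simp add: mult.commute)
    next
      case 2
      then have "Ln (\<i> * q) = Ln (of_real (- q) * (- \<i>))" by (simp add: mult.commute)
      also have "\<dots> = ln (- q) + Ln (- \<i>)" using 2 Ln_times_of_real[of "- q" "- \<i>"] Ln_of_real[of "- q"] by simp
      finally show ?thesis using 2 by simp
    qed
  qed
  moreover have "sgn q = - sgn (Re z)"
    using \<open>Im z < 1\<close> assms by (auto simp: q_def sgn_real_def divide_simps)
  ultimately show ?thesis by (simp add: Arctan_def eq)
qed

text \<open>Up to the factor \<open>4 / pi\<close> this is the Abel mean of the Fourier series of
  the square wave \<open>sgn (cos (2 * pi * x))\<close>.\<close>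

lemma Re_Arctan_scaled_e_sums:
  fixes r :: real
  assumes "0 \<le> r" "r < 1"
  shows "(\<lambda>k. (-1) ^ k / (2 * real k + 1) * r ^ (2 * k + 1) * cos (2 * pi * (real (2 * k + 1) * x)))
    sums Re (Arctan (r * e x))"
proof -
  have "(\<lambda>k. (-1) ^ k / of_nat (2 * k + 1) * (r * e x) ^ (2 * k + 1)) sums Arctan (r * e x)"
    by (rule Arctan_series(2)) (use assms in \<open>simp add: norm_mult\<close>)
  then have "(\<lambda>k. Re ((-1) ^ k / of_nat (2 * k + 1) * (r * e x) ^ (2 * k + 1))) sums Re (Arctan (r * e x))"
    by (rule sums_Re)
  moreover have "(-1) ^ k / of_nat (2 * k + 1) * (r * e x) ^ (2 * k + 1)
      = of_real ((-1) ^ k / (2 * real k + 1) * r ^ (2 * k + 1)) * e (real (2 * k + 1) * x)" for k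
    unfolding power_mult_distrib e_power by (simp add: add.commute)
  ultimately show ?thesis by (simp only: Re_complex_of_real Re_e times_complex.sel Im_complex_of_real mult_zero_left diff_0_right)
qed

text \<open>Makes the jumps of the square wave a null set.\<close>

lemma countable_cos_zeros:
  assumes "c \<noteq> 0"
  shows "countable {x::real. cos (c * x) = 0}"
proof (rule countable_subset)
  show "{x. cos (c * x) = 0} \<subseteq> range (\<lambda>i::int. of_int i * (pi / 2) / c)"
  proof
    fix x assume "x \<in> {x. cos (c * x) = 0}"
    then obtain i :: int where "c * x = of_int i * (pi / 2)" by (auto simp: cos_zero_iff_int)
    then have "x = of_int i * (pi / 2) / c" using assms by (simp add: field_simps)
    then show "x \<in> range (\<lambda>i::int. of_int i * (pi / 2) / c)" by blast
  qed
qed simp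

text \<open>The Fourier series of \<open>sgn \<circ> cos\<close> may be integrated termwise: its Abel means are
  \<open>4 / \<pi>\<close> times the real part of \<open>Arctan\<close> and hence uniformly bounded.\<close>
lemma integral_sgn_cos:
  fixes h :: "real \<Rightarrow> complex"
  assumes h: "integrable circ h" and m: "m > 0"
    and a: "\<And>k. integral\<^sup>L circ (\<lambda>x. cos (2 * pi * (real (2 * k + 1) * (real m * x))) *\<^sub>R h x) = a k"
    and sm: "summable (\<lambda>k. cmod (a k) / (2 * real k + 1))"
  shows "integral\<^sup>L circ (\<lambda>x. sgn (cos (2 * pi * (real m * x))) *\<^sub>R h x)
    = (4 / pi) *\<^sub>R (\<Sum>k. ((-1) ^ k / (2 * real k + 1)) *\<^sub>R a k)"
proof -
  \<comment> \<open>\<open>A r\<close> is \<open>pi / 4\<close> times the Abel mean of the square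
    wave, and \<open>w r k\<close> are its cosine coefficients.\<close>
  define A where "A r x = Re (Arctan (of_real r * e (real m * x)))" for r x
  define w where "w r k = (-1) ^ k / (2 * real k + 1) * r ^ (2 * k + 1)" for r :: real and k
  define r where "r j = real j / real (Suc j)" for j
  have r: "0 \<le> r j" "r j < 1" for j unfolding r_def by (rule n_over_Suc_n_bounds)+
  have rlim: "r \<longlonglongrightarrow> 1" unfolding r_def[abs_def] by (rule LIMSEQ_n_over_Suc_n)
  \<comment> \<open>The first bound is uniform in \<open>j\<close> and serves the limit of the
    series; the second is geometric and serves termwise integration for fixed
    \<open>j\<close>.\<close>
  have w_le: "\<bar>w (r j) k\<bar> \<le> 1 / (2 * real k + 1)" "\<bar>w (r j) k\<bar> \<le> r j ^ k" for j k
  proof -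
    have 1: "\<bar>w (r j) k\<bar> = 1 / (2 * real k + 1) * r j ^ (2 * k + 1)"
      using r[of j] by (simp add: w_def abs_mult power_abs)
    have "r j ^ (2 * k + 1) \<le> 1" using r[of j] by (intro power_le_one) auto
    then show "\<bar>w (r j) k\<bar> \<le> 1 / (2 * real k + 1)" unfolding 1
      by (intro mult_left_le) auto
    have "1 / (2 * real k + 1) * r j ^ (2 * k + 1) \<le> 1 * r j ^ k"
      using r[of j] by (intro mult_mono power_decreasing) auto
    then show "\<bar>w (r j) k\<bar> \<le> r j ^ k" unfolding 1 by simp
  qed
  have int_cos: "integrable circ (\<lambda>x. cos (2 * pi * (real (2 * k + 1) * (real m * x))) *\<^sub>R h x)" for k
    by (rule Bochner_Integration.integrable_bound[OF h])
       (auto intro!: borel_measurable_scaleR[OF measurable_circ borel_measurable_integrable[OF h]]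
         mult_left_le_one_le)
  have ser: "(\<lambda>k. w (r j) k *\<^sub>R a k) sums integral\<^sup>L circ (\<lambda>x. A (r j) x *\<^sub>R h x)" for j
  proof -
    define F where "F k x = w (r j) k *\<^sub>R (cos (2 * pi * (real (2 * k + 1) * (real m * x))) *\<^sub>R h x)" for k x
    have sum_r: "summable (\<lambda>k. r j ^ k * c)" for c
      using r[of j] by (intro summable_mult2 summable_geometric) auto
    have bnd: "norm (F k x) \<le> r j ^ k * cmod (h x)" for k x
    proof -
      have "norm (F k x) = \<bar>w (r j) k\<bar> * (\<bar>cos (2 * pi * (real (2 * k + 1) * (real m * x)))\<bar> * cmod (h x))"
        unfolding F_def norm_scaleR ..
      also have "\<dots> \<le> r j ^ k * (1 * cmod (h x))"
        using w_le(2)[where j=j] r[of j] by (intro mult_mono) auto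
      finally show ?thesis by simp
    qed
    have F: "integrable circ (F k)" for k
      unfolding F_def by (intro integrable_scaleR_right int_cos)
    have "(\<lambda>k. integral\<^sup>L circ (F k)) sums integral\<^sup>L circ (\<lambda>x. \<Sum>k. F k x)"
    proof (rule sums_integral[OF F])
      show "AE x in circ. summable (\<lambda>k. norm (F k x))"
        by (intro AE_I2 summable_comparison_test'[OF sum_r]) (use bnd in auto)
      have "norm (integral\<^sup>L circ (\<lambda>x. norm (F k x))) \<le> r j ^ k * integral\<^sup>L circ (\<lambda>x. cmod (h x))" for k
      proof -
        have "integral\<^sup>L circ (\<lambda>x. norm (F k x)) \<le> integral\<^sup>L circ (\<lambda>x. r j ^ k * cmod (h x))"
          by (intro integral_mono integrable_norm F integrable_mult_right h) (use bnd in auto)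
        then show ?thesis by simp
      qed
      then show "summable (\<lambda>k. integral\<^sup>L circ (\<lambda>x. norm (F k x)))"
        by (intro summable_comparison_test'[OF sum_r])
    qed
    moreover have "integral\<^sup>L circ (F k) = w (r j) k *\<^sub>R a k" for k
      unfolding F_def integral_scaleR_right a ..
    moreover have "(\<Sum>k. F k x) = A (r j) x *\<^sub>R h x" for x
      unfolding F_def A_def w_def scaleR_scaleR
      by (rule sums_unique[symmetric], intro sums_scaleR_left Re_Arctan_scaled_e_sums[OF r])
    ultimately show ?thesis by simp
  qed
  \<comment> \<open>Dominated convergence for series, with the summable majorant
    \<open>sm\<close>.\<close>
  have lim1: "(\<lambda>j. \<Sum>k. w (r j) k *\<^sub>R a k) \<longlonglongrightarrow> (\<Sum>k. w 1 k *\<^sub>R a k)"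
  proof (rule tannerys_theorem[THEN conjunct2, THEN conjunct2])
    show "(\<lambda>j. w (r j) k *\<^sub>R a k) \<longlonglongrightarrow> w 1 k *\<^sub>R a k" for k
      unfolding w_def by (intro tendsto_intros rlim)
    show "\<forall>\<^sub>F (k, j) in at_top \<times>\<^sub>F at_top. norm (w (r j) k *\<^sub>R a k) \<le> cmod (a k) / (2 * real k + 1)"
      using mult_right_mono[OF w_le(1) norm_ge_zero]
      by (intro always_eventually) auto
  qed (use sm in auto)
  have eq: "(\<Sum>k. w (r j) k *\<^sub>R a k) = integral\<^sup>L circ (\<lambda>x. A (r j) x *\<^sub>R h x)" for j
    using ser sums_unique by metis
  have lim2: "(\<lambda>j. integral\<^sup>L circ (\<lambda>x. A (r j) x *\<^sub>R h x))
      \<longlonglongrightarrow> integral\<^sup>L circ (\<lambda>x. (pi / 4) *\<^sub>R (sgn (cos (2 * pi * (real m * x))) *\<^sub>R h x))"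
  proof (rule integral_dominated_convergence[where w="\<lambda>x. pi / 2 * cmod (h x)"])
    show "integrable circ (\<lambda>x. pi / 2 * cmod (h x))" by (intro integrable_mult_right integrable_norm h)
    have cA: "continuous_on UNIV (A (r j))" for j
      unfolding A_def
    proof (intro continuous_on_Re continuous_on_compose2[OF continuous_on_Arctan[of "ball 0 1"]])
      show "\<bar>Im z\<bar> < 1" if "z \<in> ball 0 1" for z
        using abs_Im_le_cmod[of z] that by simp
      show "continuous_on UNIV (\<lambda>x. of_real (r j) * e (real m * x))"
        by (intro continuous_intros)
    qed (use r[of j] in \<open>auto simp: norm_mult\<close>)
    show "(\<lambda>x. A (r j) x *\<^sub>R h x) \<in> borel_measurable circ" for j
      by (intro borel_measurable_scaleR[OF measurable_circ borel_measurable_integrable[OF h]]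
          borel_measurable_continuous_onI cA)
    show "(\<lambda>x. (pi / 4) *\<^sub>R (sgn (cos (2 * pi * (real m * x))) *\<^sub>R h x)) \<in> borel_measurable circ"
      by (intro borel_measurable_scaleR[OF borel_measurable_const]
          borel_measurable_scaleR[OF measurable_circ borel_measurable_integrable[OF h]]) simp
    have "AE x in circ. x \<notin> {x. cos (2 * pi * real m * x) = 0}"
      by (intro AE_circ_countable countable_cos_zeros) (use m in auto)
    then have nz: "AE x in circ. cos (2 * pi * (real m * x)) \<noteq> 0" by (simp add: mult.assoc)
    then show "AE x in circ. (\<lambda>j. A (r j) x *\<^sub>R h x)
        \<longlonglongrightarrow> (pi / 4) *\<^sub>R (sgn (cos (2 * pi * (real m * x))) *\<^sub>R h x)"
    proof eventually_elim
      case (elim x)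
      \<comment> \<open>The branch cuts of \<open>Arctan\<close> lie on the imaginary axis, which a
        nonzero cosine avoids.\<close>
      have "isCont Arctan (of_real 1 * e (real m * x))"
        using elim by (intro continuous_at_Arctan) (auto simp: Re_e)
      moreover have "(\<lambda>j. of_real (r j) * e (real m * x)) \<longlonglongrightarrow> of_real 1 * e (real m * x)"
        by (intro tendsto_intros rlim)
      ultimately have "(\<lambda>j. Arctan (of_real (r j) * e (real m * x))) \<longlonglongrightarrow> Arctan (of_real 1 * e (real m * x))"
        by (rule isCont_tendsto_compose)
      then have "(\<lambda>j. A (r j) x) \<longlonglongrightarrow> pi / 4 * sgn (cos (2 * pi * (real m * x)))"
        using Re_Arctan_unit_circle[of "e (real m * x)"] elim unfolding A_def
        by (simp only: Re_e norm_e of_real_1 mult_1 not_False_eq_True) (metis tendsto_Re)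
      then have "(\<lambda>j. A (r j) x *\<^sub>R h x) \<longlonglongrightarrow> (pi / 4 * sgn (cos (2 * pi * (real m * x)))) *\<^sub>R h x"
        by (intro tendsto_intros)
      then show ?case by simp
    qed
    show "AE x in circ. norm (A (r j) x *\<^sub>R h x) \<le> pi / 2 * cmod (h x)" for j
    proof (intro AE_I2)
      fix x
      have c: "cmod (of_real (r j) * e (real m * x)) < 1" using r[of j] by (simp add: norm_mult)
      have "\<bar>A (r j) x\<bar> < pi / 2" unfolding A_def
        by (intro Re_Arctan_bounds) (use c abs_Im_le_cmod[of "of_real (r j) * e (real m * x)"] in linarith)
      then show "norm (A (r j) x *\<^sub>R h x) \<le> pi / 2 * cmod (h x)"
        using mult_right_mono[OF less_imp_le norm_ge_zero] unfolding norm_scaleR by blast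
    qed
  qed
  have "(\<Sum>k. w 1 k *\<^sub>R a k)
      = (pi / 4) *\<^sub>R integral\<^sup>L circ (\<lambda>x. sgn (cos (2 * pi * (real m * x))) *\<^sub>R h x)"
    using LIMSEQ_unique[OF lim1[unfolded eq] lim2] by (simp only: integral_scaleR_right)
  then show ?thesis by (simp add: w_def)
qed

section \<open>Pairing trigonometric polynomials and the logarithm with the square wave\<close>

lemma trig_poly_diff: "trig_poly N c x - trig_poly N d x = trig_poly N (\<lambda>n. c n - d n) x"
  by (simp add: trig_poly_def sum_subtractf left_diff_distrib)

lemma continuous_on_trig_poly [continuous_intros]: "continuous_on S (trig_poly N c)"
  unfolding trig_poly_def by (intro continuous_intros)

lemma integrable_trig_poly: "integrable circ (trig_poly N c)"
  by (intro integrable_circ_continuous continuous_intros)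

text \<open>Every frequency \<open>(2 * k + 1) * m\<close> of the square wave exceeds
  \<open>N\<close>, so all pairings \<open>a k\<close> are zero.\<close>

lemma integral_sgn_cos_trig_poly:
  assumes "N < m"
  shows "integral\<^sup>L circ (\<lambda>x. sgn (cos (2 * pi * (real m * x))) *\<^sub>R trig_poly N c x) = 0"
proof (subst integral_sgn_cos[where a="\<lambda>_. 0"])
  fix k
  have int: "integrable circ (\<lambda>x. cos (2 * pi * (real l * x)) *\<^sub>R e (of_int n * x))" for l n
    by (intro integrable_circ_continuous continuous_intros)
  define l where "l = (2 * k + 1) * m"
  have l: "l > N" using assms by (simp add: l_def)
  have ang: "2 * pi * (real (2 * k + 1) * (real m * x)) = 2 * pi * (real l * x)" for x
    by (simp add: l_def algebra_simps)
  have "cos (2 * pi * (real (2 * k + 1) * (real m * x))) *\<^sub>R trig_poly N c x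
      = (\<Sum>n\<in>{-int N..int N}. c n * (cos (2 * pi * (real l * x)) *\<^sub>R e (of_int n * x)))" for x
    unfolding ang trig_poly_def by (simp add: scaleR_sum_right)
  moreover have "integral\<^sup>L circ (\<lambda>x. \<Sum>n\<in>{-int N..int N}. c n * (cos (2 * pi * (real l * x)) *\<^sub>R e (of_int n * x))) = 0"
  proof -
    have "integral\<^sup>L circ (\<lambda>x. \<Sum>n\<in>{-int N..int N}. c n * (cos (2 * pi * (real l * x)) *\<^sub>R e (of_int n * x)))
      = (\<Sum>n\<in>{-int N..int N}. c n * ((of_bool (n = - int l) + of_bool (n = int l)) / 2))"
      unfolding integral_cos_mult_e[symmetric] integral_mult_right_zero[symmetric]
      by (intro Bochner_Integration.integral_sum integrable_mult_right int)
    also have "\<dots> = 0" using l by (intro sum.neutral) auto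
    finally show ?thesis .
  qed
  ultimately show "integral\<^sup>L circ (\<lambda>x. cos (2 * pi * (real (2 * k + 1) * (real m * x))) *\<^sub>R trig_poly N c x) = 0"
    by simp
qed (use assms integrable_trig_poly in auto)

lemma summable_catalan: "summable (\<lambda>k. 1 / (2 * real k + 1) ^ 2)"
proof (rule summable_comparison_test'[where N=1])
  show "summable (\<lambda>k. 1 / real k ^ 2)" using inverse_power_summable[of 2] by (simp add: field_simps)
  show "norm (1 / (2 * real k + 1) ^ 2) \<le> 1 / real k ^ 2" if "1 \<le> k" for k
    using that by (auto intro!: divide_left_mono power_mono)
qed

text \<open>The logarithm contributes a second factor \<open>1 / (2 * k + 1)\<close> at the
  frequency \<open>(2 * k + 1) * m\<close>, which produces the squares in Catalan's series.\<close>

lemma integral_sgn_cos_ln: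
  assumes m: "m > 0"
  shows "integral\<^sup>L circ (\<lambda>x. sgn (cos (2 * pi * (real m * x))) *\<^sub>R complex_of_real (ln (cmod (1 - e x))))
    = - of_real (2 * catalan_G / (real m * pi))"
proof -
  define a where "a k = complex_of_real (- (1 / (real (2 * k + 1) * real m)) / 2)" for k
  have na: "cmod (a k) / (2 * real k + 1) = 1 / (2 * real m) * (1 / (2 * real k + 1) ^ 2)" for k
    unfolding a_def norm_of_real by (simp add: field_simps power2_eq_square)
  have sm: "summable (\<lambda>k. cmod (a k) / (2 * real k + 1))"
    unfolding na by (intro summable_mult summable_catalan)
  have "integral\<^sup>L circ (\<lambda>x. sgn (cos (2 * pi * (real m * x))) *\<^sub>R complex_of_real (ln (cmod (1 - e x))))
    = (4 / pi) *\<^sub>R (\<Sum>k. ((-1) ^ k / (2 * real k + 1)) *\<^sub>R a k)"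
  proof (rule integral_sgn_cos[OF _ m _ sm])
    fix k
    have ang: "2 * pi * (real (2 * k + 1) * (real m * x)) = 2 * pi * (real ((2 * k + 1) * m) * x)" for x
      by (simp add: algebra_simps)
    have "integral\<^sup>L circ (\<lambda>x. cos (2 * pi * (real (2 * k + 1) * (real m * x))) *\<^sub>R complex_of_real (ln (cmod (1 - e x))))
      = complex_of_real (integral\<^sup>L circ (\<lambda>x. ln (cmod (1 - e x)) * cos (2 * pi * (real ((2 * k + 1) * m) * x))))"
      unfolding ang integral_complex_of_real[symmetric] scaleR_conv_of_real of_real_mult
      by (simp only: mult.commute)
    then show "integral\<^sup>L circ (\<lambda>x. cos (2 * pi * (real (2 * k + 1) * (real m * x))) *\<^sub>R complex_of_real (ln (cmod (1 - e x)))) = a k"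
      unfolding integral_ln_mult_cos unfolding a_def of_nat_mult .
  qed (intro integrable_of_real integrable_ln_cmod_1_minus_e)
  also have "(\<lambda>k. ((-1) ^ k / (2 * real k + 1)) *\<^sub>R a k)
      = (\<lambda>k. complex_of_real (- 1 / (2 * real m) * ((-1) ^ k / (2 * real k + 1) ^ 2)))"
    by (rule ext) (simp add: a_def scaleR_conv_of_real field_simps power2_eq_square)
  also have "(\<Sum>k. complex_of_real (- 1 / (2 * real m) * ((-1) ^ k / (2 * real k + 1) ^ 2)))
      = complex_of_real (- 1 / (2 * real m) * catalan_G)"
  proof -
    have "summable (\<lambda>k. (-1) ^ k / (2 * real k + 1) ^ 2 :: real)"
      by (rule summable_norm_cancel) (simp add: norm_divide summable_catalan)
    from suminf_of_real[OF summable_mult[OF this, of "- 1 / (2 * real m)"], where 'a=complex]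
      suminf_mult[OF this, of "- 1 / (2 * real m)"] show ?thesis
      unfolding catalan_G_def by simp
  qed
  finally show ?thesis using m by (simp add: scaleR_conv_of_real field_simps)
qed

section \<open>Extremal trigonometric polynomials\<close>

text \<open>Multiplying by a character shifts the coefficients. Since \<open>c\<close> vanishes
  outside its range, the shifted sum extends by zeros to the symmetric range of
  \<open>Suc N\<close>.\<close>

lemma e_mult_trig_poly:
  fixes c :: "int \<Rightarrow> complex" and s :: int
  assumes "\<bar>s\<bar> \<le> 1" and "\<And>n. n \<notin> {-int N..int N} \<Longrightarrow> c n = 0"
  shows "e (of_int s * x) * trig_poly N c x = trig_poly (Suc N) (\<lambda>n. c (n - s)) x"
proof -
  have "e (of_int s * x) * trig_poly N c x = (\<Sum>n\<in>{-int N..int N}. c n * e (of_int (n + s) * x))"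
    by (simp add: trig_poly_def sum_distrib_left e_add ring_distribs mult_ac)
  also have "\<dots> = (\<Sum>n\<in>{-int N + s..int N + s}. c (n - s) * e (of_int n * x))"
    by (rule sum.reindex_bij_witness[where i="\<lambda>n. n - s" and j="\<lambda>n. n + s"]) auto
  also have "\<dots> = (\<Sum>n\<in>{-int (Suc N)..int (Suc N)}. c (n - s) * e (of_int n * x))"
    using assms by (intro sum.mono_neutral_left) auto
  finally show ?thesis by (simp add: trig_poly_def)
qed

text \<open>Horner's scheme: \<open>P = a + t Q\<close>, and multiplication by the cosine averages
  the shifts by 1 and -1.\<close>

lemma poly_cos_eq_trig_poly:
  assumes "degree P \<le> N"
  shows "\<exists>c. \<forall>x. trig_poly N c x = complex_of_real (poly P (cos (2 * pi * x)))"
  using assms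
proof (induction N arbitrary: P)
  case 0
  then obtain a where P: "P = [:a:]" by (metis degree_eq_zeroE le_zero_eq)
  show ?case by (rule exI[of _ "\<lambda>_. of_real a"]) (simp add: P trig_poly_def)
next
  case (Suc N)
  obtain a Q where P: "P = pCons a Q" by (cases P)
  have "degree Q \<le> N" using Suc.prems unfolding P by (auto simp: degree_pCons_eq_if split: if_splits)
  then obtain c0 where c0: "\<forall>x. trig_poly N c0 x = complex_of_real (poly Q (cos (2 * pi * x)))"
    using Suc.IH by blast
  \<comment> \<open>Coefficients outside the range are arbitrary and must be cut off before
    shifting.\<close>
  define c where "c n = (if n \<in> {-int N..int N} then c0 n else 0)" for n
  have c: "trig_poly N c x = complex_of_real (poly Q (cos (2 * pi * x)))" for x
    using c0 by (simp add: trig_poly_def c_def)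
  define A where "A n = (if n = 0 then complex_of_real a else 0)" for n :: int
  have A: "trig_poly (Suc N) A x = a" for x
  proof -
    have "trig_poly (Suc N) A x = (\<Sum>n\<in>{0}. A n * e (of_int n * x))"
      unfolding trig_poly_def by (rule sum.mono_neutral_right) (auto simp: A_def)
    then show ?thesis by (simp add: A_def)
  qed
  have "trig_poly (Suc N) (\<lambda>n. A n + (c (n - 1) + c (n - (- 1))) / 2) x
      = complex_of_real (poly P (cos (2 * pi * x)))" for x
  proof -
    have "trig_poly (Suc N) (\<lambda>n. A n + (c (n - 1) + c (n - (- 1))) / 2) x
      = a + (trig_poly (Suc N) (\<lambda>n. c (n - 1)) x + trig_poly (Suc N) (\<lambda>n. c (n - (- 1))) x) / 2"
      unfolding A[of x, symmetric] trig_poly_def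
      by (simp only: sum.distrib distrib_right add_divide_distrib sum_divide_distrib times_divide_eq_left)
    also have "\<dots> = a + (e (of_int 1 * x) * trig_poly N c x + e (of_int (- 1) * x) * trig_poly N c x) / 2"
      by (subst (1 2) e_mult_trig_poly[symmetric]) (auto simp: c_def)
    also have "\<dots> = a + (e x + e (- x)) / 2 * trig_poly N c x"
      by (simp add: algebra_simps)
    finally show ?thesis unfolding cos_eq_e[symmetric] c by (simp add: P)
  qed
  then show ?case by blast
qed

text \<open>Multiplied by \<open>e (N * x)\<close>, the sum becomes a polynomial of degree at most
  \<open>2 N\<close> in \<open>e x\<close>, and \<open>e\<close> is injective on the open unit
  interval.\<close>

lemma trig_poly_eq_0:
  assumes "finite X" "card X > 2 * N" "X \<subseteq> {0<..<1}" "\<And>x. x \<in> X \<Longrightarrow> trig_poly N c x = 0"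
  shows "trig_poly N c y = 0"
proof -
  define Q where "Q = (\<Sum>k\<le>2 * N. monom (c (int k - int N)) k)"
  have Q: "poly Q (e x) = e (real N * x) * trig_poly N c x" for x
  proof -
    have "e (real N * x) * trig_poly N c x = (\<Sum>n\<in>{-int N..int N}. c n * e ((of_int n + real N) * x))"
      by (simp add: trig_poly_def sum_distrib_left e_add ring_distribs mult_ac)
    also have "\<dots> = (\<Sum>k\<le>2 * N. c (int k - int N) * e (real k * x))"
      by (rule sum.reindex_bij_witness[where i="\<lambda>k. int k - int N" and j="\<lambda>n. nat (n + int N)"]) auto
    also have "\<dots> = poly Q (e x)"
      by (simp add: Q_def poly_sum poly_monom e_power)
    finally show ?thesis ..
  qed
  have inj: "inj_on e X"
  proof (rule inj_onI)
    fix x y assume xy: "x \<in> X" "y \<in> X" "e x = e y"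
    then obtain n :: int where n: "x = y + of_int n" by (auto simp: e_eq_iff)
    have "x \<in> {0<..<1}" "y \<in> {0<..<1}" using assms(3) xy by blast+
    then have "\<bar>x - y\<bar> < 1" by auto
    then show "x = y" using n by simp
  qed
  have dQ: "degree Q \<le> 2 * N"
    unfolding Q_def by (intro degree_sum_le) (auto intro: order_trans[OF degree_monom_le])
  have "Q = 0"
    by (rule poly_eqI_degree[where A="e ` X"])
       (use assms Q dQ card_image[OF inj] in auto)
  then have "e (real N * y) * trig_poly N c y = 0" using Q[of y] by simp
  moreover have "e (real N * y) \<noteq> 0" by (metis norm_e norm_zero zero_neq_one)
  ultimately show ?thesis by simp
qed

text \<open>Dividing by \<open>x - x\<^sub>0\<close> and letting \<open>x\<close> tend to \<open>x\<^sub>0\<close> from either side yields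
  \<open>\<bar>C'\<bar> |H| = C' Re H\<close> and \<open>\<bar>C'\<bar> |H| = - C' Re H\<close> at \<open>x\<^sub>0\<close>.\<close>
lemma eq_0_at_sign_change:
  fixes C :: "real \<Rightarrow> real" and H :: "real \<Rightarrow> complex"
  assumes C: "(C has_real_derivative C') (at x0)" "C' \<noteq> 0" "C x0 = 0"
    and H: "isCont H x0"
    and eq: "\<forall>\<^sub>F x in at x0. \<bar>C x\<bar> * cmod (H x) + C x * Re (H x) = 0"
  shows "H x0 = 0"
proof -
  define q where "q x = C x / (x - x0)" for x
  have q: "(q \<longlongrightarrow> C') (at x0)"
    using C(1,3) unfolding has_field_derivative_iff q_def by simp
  have Ht: "(H \<longlongrightarrow> H x0) (at x0)" using H by (simp add: isCont_def)
  \<comment> \<open>The parameter \<open>s\<close> is the sign of \<open>x - x0\<close>: 1 on the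
    right and -1 on the left.\<close>
  have lim: "((\<lambda>x. s * (\<bar>q x\<bar> * cmod (H x)) + q x * Re (H x)) \<longlongrightarrow>
      s * (\<bar>C'\<bar> * cmod (H x0)) + C' * Re (H x0)) F" if "F \<le> at x0" for s F
    by (intro tendsto_intros tendsto_mono[OF that] q Ht)
  have "\<forall>\<^sub>F x in at_right x0. 1 * (\<bar>q x\<bar> * cmod (H x)) + q x * Re (H x) = 0"
    using eventually_at_right_less[of x0] filter_leD[OF at_le[OF subset_UNIV] eq]
    by eventually_elim (simp add: q_def abs_divide flip: add_divide_distrib)
  then have 1: "1 * (\<bar>C'\<bar> * cmod (H x0)) + C' * Re (H x0) = 0"
    by (intro tendsto_unique[OF _ lim[OF at_le[OF subset_UNIV]] tendsto_eventually]) auto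
  have less: "\<forall>\<^sub>F x in at_left x0. x < x0" by (simp add: eventually_at_filter)
  have "\<forall>\<^sub>F x in at_left x0. - 1 * (\<bar>q x\<bar> * cmod (H x)) + q x * Re (H x) = 0"
    using less filter_leD[OF at_le[OF subset_UNIV] eq]
  proof eventually_elim
    case (elim x)
    then have "\<bar>q x\<bar> = - (\<bar>C x\<bar> / (x - x0))" by (simp add: q_def abs_divide divide_simps algebra_simps)
    then show ?case using elim by (simp add: q_def flip: add_divide_distrib)
  qed
  then have "- 1 * (\<bar>C'\<bar> * cmod (H x0)) + C' * Re (H x0) = 0"
    by (intro tendsto_unique[OF _ lim[OF at_le[OF subset_UNIV]] tendsto_eventually]) auto
  with 1 show ?thesis using C(2) by auto
qed

text \<open>The set where \<open>G\<close> is nonzero is open and null, hence empty. The open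
  interval leaves out the logarithmic singularity at the endpoints.\<close>

lemma AE_circ_eq_0_continuous:
  fixes G :: "real \<Rightarrow> real"
  assumes "AE x in circ. G x = 0" "continuous_on {0<..<1} G" "x \<in> {0<..<1}"
  shows "G x = 0"
proof -
  define U where "U = {0<..<1} \<inter> G -` (- {0})"
  have "open U" unfolding U_def
    by (rule continuous_open_preimage[OF assms(2)]) auto
  have "AE x in lborel. x \<in> {0..1} \<longrightarrow> G x = 0"
    using assms(1) unfolding circ_def by (subst (asm) AE_restrict_space_iff) auto
  then have "AE x in lborel. x \<notin> U" by eventually_elim (auto simp: U_def)
  then have "U \<in> null_sets lborel" using \<open>open U\<close> by (subst AE_iff_null_sets) auto
  then have "negligible U" by (simp add: negligible_iff_null_sets null_sets_completionI)
  then have "U = {}" using open_not_negligible \<open>open U\<close> by blast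
  then show ?thesis using assms(3) by (auto simp: U_def)
qed

text \<open>Interpolation at \<open>N + 1\<close> nodes has degree at most \<open>N\<close> in the
  cosine, so it yields a real trigonometric polynomial of degree at most \<open>N\<close>; the error
  sign comes from the Chebyshev polynomial.\<close>

lemma best_approximation_exists:
  fixes N :: nat
  shows "\<exists>c. (\<forall>x. trig_poly N c x \<in> \<real>) \<and> (\<forall>x. 0 < x \<and> x < 1 \<longrightarrow>
    cmod (ln (cmod (1 - e x)) - trig_poly N c x) =
      - Re (sgn (cos (2 * pi * (real (Suc N) * x))) *\<^sub>R (ln (cmod (1 - e x)) - trig_poly N c x)))"
proof -
  define m where "m = Suc N"
  obtain T :: "real poly" where T: "degree T \<le> m" "coeff T m > 0" "\<And>\<theta>. poly T (cos \<theta>) = cos (real m * \<theta>)"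
    using exists_Chebyshev_poly by blast
  \<comment> \<open>The zeros of \<open>cos (m \<theta>)\<close> in the open interval from 0 to
    \<open>pi\<close>. They give distinct cosines below 1, where the logarithm is smooth.\<close>
  define \<theta> where "\<theta> j = (2 * real j + 1) * pi / (2 * real m)" for j
  have \<theta>: "0 < \<theta> j" "\<theta> j < pi" if "j < m" for j
  proof -
    have "(2 * real j + 1) * pi < 2 * real m * pi" using that by (intro mult_strict_right_mono) auto
    then show "0 < \<theta> j" "\<theta> j < pi"
      using that by (auto simp: \<theta>_def pos_divide_less_eq mult.commute intro!: divide_pos_pos mult_pos_pos)
  qed
  define S where "S = (\<lambda>j. cos (\<theta> j)) ` {..<m}"
  have "inj_on (\<lambda>j. cos (\<theta> j)) {..<m}"
  proof (rule inj_onI)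
    fix i j assume ij: "i \<in> {..<m}" "j \<in> {..<m}" "cos (\<theta> i) = cos (\<theta> j)"
    have b: "0 \<le> \<theta> k" "\<theta> k \<le> pi" if "k \<in> {..<m}" for k
      using \<theta>[of k] that by simp_all
    have "\<theta> i = \<theta> j" using b[OF ij(1)] b[OF ij(2)] ij(3) by (rule cos_inj_pi)
    moreover have "real m \<noteq> 0" by (simp add: m_def)
    ultimately show "i = j" unfolding \<theta>_def by simp
  qed
  then have S: "finite S" "card S = m" by (auto simp: S_def card_image)
  have S1: "S \<subseteq> {..<1}"
  proof
    fix s assume "s \<in> S"
    then obtain j where "j < m" "s = cos (\<theta> j)" by (auto simp: S_def)
    then show "s \<in> {..<1}" using cos_monotone_0_pi[of 0 "\<theta> j"] \<theta>[of j] by simp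
  qed
  have TS: "poly T s = 0" if "s \<in> S" for s
  proof -
    obtain j where j: "s = cos (\<theta> j)" using \<open>s \<in> S\<close> by (auto simp: S_def)
    have "real m \<noteq> 0" by (simp add: m_def)
    then have "real m * \<theta> j = of_int (2 * int j + 1) * (pi / 2)" by (simp add: \<theta>_def)
    then show ?thesis unfolding j T(3) cos_zero_iff_int
      by (intro exI[of _ "2 * int j + 1"] conjI) auto
  qed
  obtain P where P: "degree P \<le> m - 1" "\<And>s. s \<in> S \<Longrightarrow> poly P s = ln (2 - 2 * s) / 2"
    using exists_interpolation_poly[OF S(1), of "\<lambda>s. ln (2 - 2 * s) / 2"] S(2) by auto
  then obtain c where c: "\<And>x. trig_poly N c x = complex_of_real (poly P (cos (2 * pi * x)))"
    using poly_cos_eq_trig_poly[of P N] by (auto simp: m_def)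
  have "cmod (ln (cmod (1 - e x)) - trig_poly N c x) =
      - Re (sgn (cos (2 * pi * (real m * x))) *\<^sub>R (ln (cmod (1 - e x)) - trig_poly N c x))"
    if x: "0 < x" "x < 1" for x
  proof -
    define t where "t = cos (2 * pi * x)"
    have pos: "cmod (1 - e x) > 0" using e_neq_1[OF x] by simp
    have "2 - 2 * t = cmod (1 - e x) ^ 2" by (simp add: t_def cmod_1_minus_e)
    then have "ln (2 - 2 * t) = 2 * ln (cmod (1 - e x))" "0 < 2 - 2 * t"
      using pos by (simp_all add: ln_realpow)
    then have L: "ln (cmod (1 - e x)) = ln (2 - 2 * t) / 2" and t: "t < 1" by auto
    have Tt: "poly T t = cos (2 * pi * (real m * x))" by (simp add: t_def T(3) mult_ac)
    have "\<bar>ln (2 - 2 * t) / 2 - poly P t\<bar> = - (ln (2 - 2 * t) / 2 - poly P t) * sgn (poly T t)"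
      by (rule log_interpolation_error_sign[OF T(1,2) S S1 TS P _ t]) (simp_all add: m_def)
    then show ?thesis
      unfolding c L Tt t_def[symmetric] of_real_diff[symmetric] norm_of_real
      by (simp add: algebra_simps)
  qed
  then show ?thesis using c unfolding m_def by (intro exI[of _ c]) auto
qed

theorem theorem1p4:
  fixes N :: nat
  shows "\<exists>c :: int \<Rightarrow> complex.
           (\<forall>x. trig_poly N c x \<in> \<real>) \<and>
           (\<forall>d :: int \<Rightarrow> complex.
              log_L1_dist (trig_poly N d) \<ge> 4 * catalan_G / ((2 * real N + 2) * pi) \<and>
              (log_L1_dist (trig_poly N d) = 4 * catalan_G / ((2 * real N + 2) * pi)
                 \<longleftrightarrow> trig_poly N d = trig_poly N c))"
proof -
  define m where "m = Suc N"
  define C where "C x = cos (2 * pi * (real m * x))" for x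
  define L where "L = 4 * catalan_G / ((2 * real N + 2) * pi)"
  define H where "H d x = complex_of_real (ln (cmod (1 - e x))) - trig_poly N d x" for d x
  have dist: "log_L1_dist (trig_poly N d) = integral\<^sup>L circ (\<lambda>x. cmod (H d x))" for d
    by (simp add: log_L1_dist_def integral_circ H_def)
  have intL: "integrable circ (\<lambda>x. complex_of_real (ln (cmod (1 - e x))))"
    by (intro integrable_of_real integrable_ln_cmod_1_minus_e)
  have intH: "integrable circ (H d)" for d
    unfolding H_def by (intro Bochner_Integration.integrable_diff intL integrable_trig_poly)
  have int_sgn: "integrable circ (\<lambda>x. sgn (C x) *\<^sub>R h x)" if "integrable circ h" for h :: "real \<Rightarrow> complex"
    by (rule Bochner_Integration.integrable_bound[OF that])
       (auto intro!: borel_measurable_scaleR[OF measurable_circ borel_measurable_integrable[OF that]]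
         AE_I2 simp: C_def abs_sgn_eq)
  \<comment> \<open>The value does not depend on \<open>d\<close>, by orthogonality.\<close>
  have val: "integral\<^sup>L circ (\<lambda>x. sgn (C x) *\<^sub>R H d x) = - of_real L" for d
  proof -
    have "integral\<^sup>L circ (\<lambda>x. sgn (C x) *\<^sub>R H d x)
      = - of_real (2 * catalan_G / (real m * pi)) - 0"
      unfolding H_def scaleR_diff_right
      by (subst Bochner_Integration.integral_diff[OF int_sgn[OF intL] int_sgn[OF integrable_trig_poly]])
         (simp add: C_def integral_sgn_cos_ln integral_sgn_cos_trig_poly m_def del: of_nat_Suc)
    also have "2 * catalan_G / (real m * pi) = L"
    proof -
      have "(2 * real N + 2) * pi = 2 * (real m * pi)" by (simp add: m_def algebra_simps)
      then show ?thesis by (simp add: L_def)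
    qed
    finally show ?thesis by simp
  qed
  \<comment> \<open>The integral of this nonnegative function is the excess of the distance over
    \<open>L\<close>: it gives the bound, and equality holds exactly when the function vanishes
    almost everywhere.\<close>
  have nonneg: "0 \<le> cmod (H d x) + Re (sgn (C x) *\<^sub>R H d x)" for d x
    using abs_Re_le_cmod[of "H d x"] by (auto simp: sgn_real_def)
  have int_gap: "integrable circ (\<lambda>x. cmod (H d x) + Re (sgn (C x) *\<^sub>R H d x))" for d
    by (intro Bochner_Integration.integrable_add integrable_norm integrable_Re int_sgn intH)
  have gap: "integral\<^sup>L circ (\<lambda>x. cmod (H d x) + Re (sgn (C x) *\<^sub>R H d x))
      = log_L1_dist (trig_poly N d) - L" for d
    by (subst Bochner_Integration.integral_add)
       (auto intro!: integrable_norm integrable_Re int_sgn intH simp: dist integral_Re[OF int_sgn[OF intH]] val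
         simp del: scaleR_complex.sel)
  have lower: "log_L1_dist (trig_poly N d) \<ge> L" for d
    using integral_nonneg_AE[of "\<lambda>x. cmod (H d x) + Re (sgn (C x) *\<^sub>R H d x)" circ] nonneg
    unfolding gap by simp
  obtain c where real: "\<forall>x. trig_poly N c x \<in> \<real>"
    and c: "\<And>x. 0 < x \<Longrightarrow> x < 1 \<Longrightarrow> cmod (H c x) = - Re (sgn (C x) *\<^sub>R H c x)"
    using best_approximation_exists[of N] unfolding H_def C_def m_def by blast
  have "AE x in circ. cmod (H c x) + Re (sgn (C x) *\<^sub>R H c x) = 0"
    using AE_circ_open by eventually_elim (simp add: c)
  then have opt: "log_L1_dist (trig_poly N c) = L"
    using integral_nonneg_eq_0_iff_AE[OF int_gap, of c] nonneg unfolding gap by simp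
  \<comment> \<open>The \<open>2 m\<close> sign changes of \<open>C\<close> in the open unit
    interval.\<close>
  define X where "X = (\<lambda>j. (2 * real j + 1) / (4 * real m)) ` {..<2 * m}"
  have cX: "card X = 2 * m" "finite X" unfolding X_def
    by (subst card_image) (auto simp: inj_on_def m_def)
  have X01: "X \<subseteq> {0<..<1}"
    unfolding X_def by (auto simp: m_def field_simps)
  have vanish: "H d x = 0" if d: "log_L1_dist (trig_poly N d) = L" and x: "x \<in> X" for d x
  proof -
    have cH: "continuous_on {0<..<1} (H d)" unfolding H_def
      by (intro continuous_intros) (use e_neq_1 in auto)
    have "AE x in circ. cmod (H d x) + Re (sgn (C x) *\<^sub>R H d x) = 0"
      using integral_nonneg_eq_0_iff_AE[OF int_gap, of d] nonneg d unfolding gap by simp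
    \<comment> \<open>Multiplying by \<open>\<bar>C x\<bar>\<close> removes the jumps of the sign,
      so that continuity upgrades the identity to every interior point.\<close>
    then have "AE x in circ. \<bar>C x\<bar> * cmod (H d x) + C x * Re (H d x) = 0"
    proof eventually_elim
      case (elim x)
      have "\<bar>C x\<bar> * cmod (H d x) + C x * Re (H d x)
        = \<bar>C x\<bar> * (cmod (H d x) + Re (sgn (C x) *\<^sub>R H d x))"
        by (simp add: distrib_left abs_mult_sgn flip: mult.assoc)
      then show ?case using elim by simp
    qed
    then have z: "\<bar>C y\<bar> * cmod (H d y) + C y * Re (H d y) = 0" if "y \<in> {0<..<1}" for y
      by (rule AE_circ_eq_0_continuous[OF _ _ that]) (unfold C_def, intro continuous_intros cH)
    obtain j where j: "x = (2 * real j + 1) / (4 * real m)" using x by (auto simp: X_def)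
    have "real m \<noteq> 0" by (simp add: m_def)
    then have "real m * x = (2 * real j + 1) / 4" by (simp add: j)
    then have "2 * pi * (real m * x) = of_int (2 * int j + 1) * (pi / 2)" by simp
    then have C0: "cos (2 * pi * (real m * x)) = 0"
      unfolding cos_zero_iff_int
      by (intro exI[of _ "2 * int j + 1"] conjI) auto
    have xI: "x \<in> {0<..<1}" using x X01 by blast
    show ?thesis
    proof (rule eq_0_at_sign_change[of C])
      show "(C has_real_derivative - sin (2 * pi * (real m * x)) * (2 * pi * real m)) (at x)"
        unfolding C_def by (auto intro!: derivative_eq_intros)
      \<comment> \<open>The zeros of \<open>C\<close> are simple, since sine and cosine have no
        common zero.\<close>
      show "- sin (2 * pi * (real m * x)) * (2 * pi * real m) \<noteq> 0"
        using C0 sin_cos_squared_add[of "2 * pi * (real m * x)"] by (auto simp: m_def)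
      show "C x = 0" using C0 by (simp add: C_def)
      show "isCont (H d) x"
        using cH xI by (simp add: continuous_on_eq_continuous_at)
      have "\<forall>\<^sub>F y in at x. y \<in> {0<..<1}"
        by (rule eventually_at_in_open'[OF _ xI]) simp
      then show "\<forall>\<^sub>F y in at x. \<bar>C y\<bar> * cmod (H d y) + C y * Re (H d y) = 0"
        by eventually_elim (rule z)
    qed
  qed
  have uniq: "trig_poly N d = trig_poly N c" if d: "log_L1_dist (trig_poly N d) = L" for d
  proof
    fix y
    \<comment> \<open>Both errors vanish on \<open>X\<close>, so the difference has
      \<open>2 N + 2\<close> zeros, more than a nonzero one of degree \<open>N\<close>
      allows.\<close>
    have z: "trig_poly N (\<lambda>n. d n - c n) x = 0" if "x \<in> X" for x
      using vanish[OF d that] vanish[OF opt that] unfolding H_def trig_poly_diff[symmetric] by simp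
    have "card X > 2 * N" unfolding cX m_def by simp
    then have "trig_poly N (\<lambda>n. d n - c n) y = 0"
      using trig_poly_eq_0[OF cX(2) _ X01 z] by blast
    then show "trig_poly N d y = trig_poly N c y" by (simp flip: trig_poly_diff)
  qed
  show ?thesis
    unfolding L_def[symmetric]
  proof (intro exI[of _ c] conjI allI iffI)
    show "trig_poly N c x \<in> \<real>" for x using real by blast
    show "log_L1_dist (trig_poly N d) \<ge> L" for d by (rule lower)
    show "trig_poly N d = trig_poly N c" if "log_L1_dist (trig_poly N d) = L" for d
      using that by (rule uniq)
    show "log_L1_dist (trig_poly N d) = L" if "trig_poly N d = trig_poly N c" for d
      unfolding that by (rule opt)
  qed
qed

end
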